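(* Let $X$ be an $r$-dimensional simplicial complex with $r\ge 2$. Then $$\lambda_{r-1,1}(X)=d_{r-1,1}^{\top}(X)$$ if and only if $f_r(X)=1$.
   Context: A simplicial complex $X$ on a finite set $V$ is a collection of subsets of $V$ closed under taking subsets, with $\emptyset\in X$. A $k$-simplex is an element of $X$ of cardinality $k+1$; $X(k)$ is the set of $k$-simplices and $f_k(X)=|X(k)|$. The dimension of $X$ is the maximum dimension of its simplices; here it is $r$. Each simplex is given a fixed orientation (a linear ordering of its vertices). The boundary map $\partial_r(X)$ sends the $r$-simplex $\sigma=[v_0,\dots,v_r]$ to $\sum_{j=0}^{r}(-1)^j[v_0,\dots,\widehat{v_j},\dots,v_r]$. For $\tau\in X(r-1)$, the incidence sign $(\sigma:\tau)\in\{1,-1,0\}$ is the coefficient of the oriented simplex $\tau$ in $\partial_r(X)\sigma$: it is $1$ if $\tau\subset\sigma$ and the orientation of $\tau$ agrees with the one induced by $\sigma$, $-1$ if $\tau\subset\sigma$ and it is opposite, and $0$ if $\tau\not\subset\sigma$. $B_r(X)$ is the real matrix with rows indexed by $X(r-1)$, columns indexed by $X(r)$, and $(\tau,\sigma)$-entry $(\sigma:\tau)$. The $(r-1)$-dimensional up-Laplacian is $L_{r-1}^{\mathrm{up}}(X)=B_r(X)B_r(X)^{\top}$, a real symmetric positive semidefinite matrix indexed by $X(r-1)$; $\lambda_{r-1,1}(X)$ is its largest eigenvalue. For $\tau\in X(r-1)$, $\deg_{r-1}(X;\tau)=|\{F\in X(r):\tau\subseteq F\}|$. The conjugate $(r-1)$-degree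 sequence is given by $d_{r-1,j}^{\top}(X)=|\{\tau\in X(r-1):\deg_{r-1}(X;\tau)\ge j\}|$ for $j\ge1$; so $d_{r-1,1}^{\top}(X)$ is the number of $(r-1)$-simplices contained in at least one $r$-simplex. *)

theory Defs
  imports
    "HOL-Library.Countable_Set"
    "HOL-Combinatorics.List_Permutation"
    "Jordan_Normal_Form.Spectral_Radius"
begin

definition abstract_complex :: "'a set \<Rightarrow> 'a set set \<Rightarrow> bool" where
  "abstract_complex V X \<longleftrightarrow>
     X \<subseteq> Pow V \<and> {} \<in> X \<and> (\<forall>\<sigma>\<in>X. \<forall>\<tau>. \<tau> \<subseteq> \<sigma> \<longrightarrow> \<tau> \<in> X)"

definition simplices :: "'a set set \<Rightarrow> nat \<Rightarrow> 'a set set" where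
  "simplices X k = {\<sigma> \<in> X. card \<sigma> = k + 1}"

definition f_number :: "'a set set \<Rightarrow> nat \<Rightarrow> nat" where
  "f_number X k = card (simplices X k)"

(* Integer-valued, since the empty simplex has dimension -1. *)
definition complex_dim :: "'a set set \<Rightarrow> int" where
  "complex_dim X = Max ((\<lambda>\<sigma>. int (card \<sigma>) - 1) ` X)"

definition orientation :: "'a set set \<Rightarrow> ('a set \<Rightarrow> 'a list) \<Rightarrow> bool" where
  "orientation X ori \<longleftrightarrow> (\<forall>\<sigma>\<in>X. distinct (ori \<sigma>) \<and> set (ori \<sigma>) = \<sigma>)"

(* For two orderings xs, ys of the same simplex: the sign of the permutation
   relating them, so that [xs] = orient_sign xs ys * [ys] as oriented simplices.
   The permutation is unique because the entries are distinct. *)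
definition orient_sign :: "'a list \<Rightarrow> 'a list \<Rightarrow> int" where
  "orient_sign xs ys =
     sign (THE p. p permutes {..<length ys} \<and> permute_list p ys = xs)"

definition omit_nth :: "nat \<Rightarrow> 'a list \<Rightarrow> 'a list" where
  "omit_nth j xs = take j xs @ drop (Suc j) xs"

(* The coefficient of the oriented simplex ori \<tau> in the boundary
   sum_j (-1)^j [v_0, ..., omit v_j, ..., v_r] of ori \<sigma> = [v_0, ..., v_r]. *)
definition incidence :: "('a set \<Rightarrow> 'a list) \<Rightarrow> 'a set \<Rightarrow> 'a set \<Rightarrow> int" where
  "incidence ori \<sigma> \<tau> =
     (\<Sum>j<length (ori \<sigma>).
        if set (omit_nth j (ori \<sigma>)) = \<tau>
        then (-1) ^ j * orient_sign (omit_nth j (ori \<sigma>)) (ori \<tau>)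
        else 0)"

(* The matrix B_k(X), for k \<ge> 1. Simplices are numbered by the library's enumeration
   from_nat_into of a finite set; a different numbering would conjugate the
   up-Laplacian below by a permutation matrix and leave its spectrum unchanged. *)
definition boundary_matrix :: "('a set \<Rightarrow> 'a list) \<Rightarrow> 'a set set \<Rightarrow> nat \<Rightarrow> real mat" where
  "boundary_matrix ori X k =
     mat (card (simplices X (k - 1))) (card (simplices X k))
       (\<lambda>(i, j). of_int (incidence ori
          (from_nat_into (simplices X k) j) (from_nat_into (simplices X (k - 1)) i)))"

definition up_laplacian :: "('a set \<Rightarrow> 'a list) \<Rightarrow> 'a set set \<Rightarrow> nat \<Rightarrow> real mat" where
  "up_laplacian ori X k =
     boundary_matrix ori X (k + 1) * transpose_mat (boundary_matrix ori X (k + 1))"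

definition largest_eigenvalue :: "real mat \<Rightarrow> real" where
  "largest_eigenvalue A = Max (spectrum A)"

definition simplex_degree :: "'a set set \<Rightarrow> nat \<Rightarrow> 'a set \<Rightarrow> nat" where
  "simplex_degree X k \<tau> = card {F \<in> simplices X (k + 1). \<tau> \<subseteq> F}"

definition conj_degree :: "'a set set \<Rightarrow> nat \<Rightarrow> nat \<Rightarrow> nat" where
  "conj_degree X k j = card {\<tau> \<in> simplices X k. simplex_degree X k \<tau> \<ge> j}"

end

theory Submission
  imports Defs
begin

text \<open>
  Write \<open>k = r - 1 \<ge> 1\<close>, let \<open>d\<close> be the number of \<open>k\<close>-simplices that lie in some
  \<open>(k + 1)\<close>-simplex, and let \<open>y\<close> be an eigenvector of \<open>B B\<^sup>T\<close> for an eigenvalue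
  \<open>\<mu> > 0\<close>. Then \<open>y\<close> is a boundary, so it is a cycle because the composition of two boundary
  maps vanishes. Adding the down-Laplacian therefore changes nothing: \<open>\<mu> y\<close> is also the image
  of \<open>y\<close> under the full Hodge Laplacian. The gain is that the Hodge Laplacian is much sparser
  than \<open>B B\<^sup>T\<close>: if two different \<open>k\<close>-simplices span a \<open>(k + 1)\<close>-simplex, their up-entry and
  their down-entry cancel (\<open>hodge_entry_off_diagonal\<close>).

  Apply the Gershgorin argument to the row of a simplex \<open>\<tau>\<close> at which \<open>|y|\<close> is largest. If
  \<open>\<tau>\<close> has degree \<open>D\<close>, its diagonal entry is \<open>D + k + 1\<close>. Of the \<open>d - 1\<close> other
  simplices that carry \<open>y\<close>, exactly \<open>(k + 1) D\<close> span a \<open>(k + 1)\<close>-simplex with \<open>\<tau>\<close> and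
  contribute nothing; each of the others contributes at most 1. Hence
  \<open>\<mu> \<le> D + k + 1 + (d - 1 - (k + 1) D) = d - k (D - 1) \<le> d\<close>.

  Equality forces \<open>D = 1\<close>, as \<open>k \<ge> 1\<close>, and it forces every simplex of positive degree that does
  not span a \<open>(k + 1)\<close>-simplex with \<open>\<tau>\<close> to meet \<open>\<tau>\<close> in \<open>k\<close> vertices. A second
  \<open>(k + 1)\<close>-simplex has too many facets away from \<open>\<tau>\<close> for this (\<open>unique_simplex\<close>).
  Conversely, if there is only one \<open>(k + 1)\<close>-simplex, then \<open>B\<close> is a single column with
  \<open>k + 2\<close> nonzero entries \<open>\<plusminus>1\<close>, and that column is an eigenvector for \<open>k + 2 = d\<close>.

  The largest eigenvalue is the maximum of the real spectrum, so it also has to be checked that this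
  spectrum is nonempty; this is the reality of the eigenvalues of a symmetric matrix.
\<close>

section \<open>Signs of vertex orderings\<close>

text \<open>The sign of the permutation that sorts a list by an injective numbering \<open>h\<close>: the product over all
  pairs of positions \<open>i < j\<close> of the sign of \<open>h (xs ! j) - h (xs ! i)\<close>. Measuring every ordering
  against one reference order replaces the permutation between two orderings by a product of two
  absolute signs.\<close>

fun list_sign :: "('a \<Rightarrow> nat) \<Rightarrow> 'a list \<Rightarrow> int" where
  "list_sign h [] = 1"
| "list_sign h (x # xs) = (\<Prod>y\<in>#mset xs. sgn (int (h y) - int (h x))) * list_sign h xs"

text \<open>The factor by which removing \<open>v\<close> from the front of an ordering of \<open>A\<close> changes its sign.\<close>

definition comparison_sign :: "('a \<Rightarrow> nat) \<Rightarrow> 'a set \<Rightarrow> 'a \<Rightarrow> int" where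
  "comparison_sign h A v = (\<Prod>y\<in>A - {v}. sgn (int (h y) - int (h v)))"

lemma list_sign_append_cong:
  assumes "mset xs = mset ys" "list_sign h xs = c * list_sign h ys"
  shows "list_sign h (as @ xs) = c * list_sign h (as @ ys)"
  using assms by (induction as) (auto simp: algebra_simps)

lemma list_sign_swap_adjacent: "list_sign h (x # y # xs) = - list_sign h (y # x # xs)"
proof -
  have "sgn (int (h y) - int (h x)) = - sgn (int (h x) - int (h y))"
    by (simp add: sgn_if)
  then show ?thesis by simp
qed

lemma list_sign_move: "list_sign h (x # bs @ cs) = (-1) ^ length bs * list_sign h (bs @ x # cs)"
proof (induction bs)
  case (Cons b bs)
  have "list_sign h (x # (b # bs) @ cs) = - list_sign h ([b] @ (x # bs @ cs))"
    using list_sign_swap_adjacent[of h x b "bs @ cs"] by simp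
  also have "list_sign h ([b] @ (x # bs @ cs)) = (-1) ^ length bs * list_sign h ([b] @ (bs @ x # cs))"
    by (rule list_sign_append_cong[OF _ Cons.IH]) simp
  finally show ?case by simp
qed simp

text \<open>Move \<open>x\<close> rightwards across \<open>bs\<close> and \<open>y\<close>, then \<open>y\<close> leftwards across \<open>bs\<close>: this takes
  \<open>2 * length bs + 1\<close> adjacent swaps.\<close>

lemma list_sign_swap: "list_sign h (as @ x # bs @ y # cs) = - list_sign h (as @ y # bs @ x # cs)"
proof -
  have "list_sign h (x # bs @ y # cs) = (-1) ^ length bs * list_sign h (bs @ x # y # cs)"
    by (rule list_sign_move)
  also have "list_sign h (bs @ x # y # cs) = - 1 * list_sign h (bs @ y # x # cs)"
    by (rule list_sign_append_cong) (use list_sign_swap_adjacent[of h x y cs] in auto)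
  also have "(-1) ^ length bs * (- 1 * list_sign h (bs @ y # x # cs)) = - list_sign h (y # bs @ x # cs)"
    using list_sign_move[of h y bs "x # cs"] by simp
  finally have "list_sign h (x # bs @ y # cs) = - 1 * list_sign h (y # bs @ x # cs)" by simp
  from list_sign_append_cong[OF _ this, of as] show ?thesis by simp
qed

lemma list_sign_transpose:
  assumes "a < b" "b < length xs"
  shows "list_sign h (permute_list (transpose a b) xs) = - list_sign h xs"
proof -
  define as bs cs where "as = take a xs" and "bs = take (b - Suc a) (drop (Suc a) xs)"
    and "cs = drop (Suc b) xs"
  have len: "length as = a" "length bs = b - Suc a" using assms by (auto simp: as_def bs_def)
  have "drop (Suc a) xs = bs @ drop b xs"
    using assms append_take_drop_id[of "b - Suc a" "drop (Suc a) xs"] by (simp add: bs_def)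
  then have xs: "xs = as @ xs ! a # bs @ xs ! b # cs"
    using assms by (metis Cons_nth_drop_Suc append_take_drop_id as_def cs_def less_trans)
  have p: "transpose a b permutes {..<length xs}"
    using assms by (intro permutes_swap_id) auto
  have "permute_list (transpose a b) xs = as @ xs ! b # bs @ xs ! a # cs"
  proof (rule nth_equalityI)
    show "length (permute_list (transpose a b) xs) = length (as @ xs ! b # bs @ xs ! a # cs)"
      using arg_cong[OF xs, of length] by simp
    fix i assume "i < length (permute_list (transpose a b) xs)"
    then have i: "i < length xs" by simp
    have eq: "xs ! i = (as @ xs ! a # bs @ xs ! b # cs) ! i" using xs by simp
    show "permute_list (transpose a b) xs ! i = (as @ xs ! b # bs @ xs ! a # cs) ! i"
    proof -
      obtain m where m: "b = Suc (a + m)" using assms(1) less_natE by blast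
      consider "i < a" | "i = a" | c where "i = Suc (a + c)" "c < m" | "i = b"
        | c where "i = Suc (b + c)"
        by (metis m add_less_cancel_left linorder_less_linear less_natE not_less_eq)
      then show ?thesis
        using assms len eq m unfolding permute_list_nth[OF p i]
        by cases (simp_all add: nth_append)
    qed
  qed
  then show ?thesis
    using list_sign_swap[of h as "xs ! b" bs "xs ! a" cs] arg_cong[OF xs, of "list_sign h"]
    by (simp only:)
qed

lemma list_sign_permute:
  assumes "p permutes {..<length xs}"
  shows "list_sign h (permute_list p xs) = sign p * list_sign h xs"
  using finite_lessThan assms
proof (induction rule: permutes_rev_induct)
  case id
  show ?case by simp
next
  case (swap a b p)
  have t: "transpose a b permutes {..<length xs}"
    using swap by (intro permutes_swap_id) auto
  have "list_sign h (permute_list (transpose a b) (permute_list p xs)) = - list_sign h (permute_list p xs)"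
  proof (cases "a < b")
    case True
    then show ?thesis using swap by (intro list_sign_transpose) auto
  next
    case False
    then show ?thesis using swap list_sign_transpose[of b a "permute_list p xs" h]
      by (simp add: transpose_commute)
  qed
  moreover have "sign (p \<circ> transpose a b) = - sign p"
    using swap t by (subst sign_compose)
      (auto simp: sign_swap_id intro: permutes_imp_permutation[OF finite_lessThan])
  ultimately show ?case
    unfolding permute_list_compose[OF t] swap.IH by (simp only: mult_minus_left)
qed

lemma list_sign_square:
  assumes "inj_on h (set xs)" "distinct xs"
  shows "list_sign h xs * list_sign h xs = 1"
  using assms
proof (induction xs)
  case (Cons x xs)
  have "\<bar>\<Prod>y\<in>#mset xs. sgn (int (h y) - int (h x))\<bar> = 1"
  proof -
    have "(\<Prod>y\<in>#mset ys. sgn (int (h y) - int (h x))) \<in> {1, -1}" if "set ys \<subseteq> set xs" for ys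
      using that Cons.prems by (induction ys) (auto simp: inj_on_def sgn_if)
    then show ?thesis by force
  qed
  then have "(\<Prod>y\<in>#mset xs. sgn (int (h y) - int (h x))) * (\<Prod>y\<in>#mset xs. sgn (int (h y) - int (h x))) = 1"
    by (metis abs_mult_self_eq mult_1)
  moreover have "list_sign h xs * list_sign h xs = 1" using Cons by simp
  ultimately show ?case
    unfolding list_sign.simps mult.assoc by (subst mult.left_commute) (simp flip: mult.assoc)
qed simp

text \<open>The orientation sign becomes a coboundary. This is what makes the signs of different simplices
  comparable, no matter which orientations were chosen.\<close>

lemma orient_sign_eq:
  assumes "inj_on h (set ys)" "distinct xs" "distinct ys" "set xs = set ys"
  shows "orient_sign xs ys = list_sign h xs * list_sign h ys"
proof -
  have "mset xs = mset ys" using assms by (simp add: set_eq_iff_mset_eq_distinct)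
  then obtain p where p: "p permutes {..<length ys}" "permute_list p ys = xs"
    by (rule mset_eq_permutation)
  have "(THE p. p permutes {..<length ys} \<and> permute_list p ys = xs) = p"
  proof (rule the_equality)
    fix q assume q: "q permutes {..<length ys} \<and> permute_list q ys = xs"
    show "q = p"
    proof
      fix i
      show "q i = p i"
      proof (cases "i < length ys")
        case True
        then have "ys ! q i = ys ! p i" "q i < length ys" "p i < length ys"
          using p q permute_list_nth permutes_in_image by (metis lessThan_iff)+
        then show ?thesis using assms(3) by (simp add: nth_eq_iff_index_eq)
      next
        case False
        then show ?thesis using p q by (simp add: permutes_def)
      qed
    qed
  qed (use p in auto)
  then have "orient_sign xs ys = sign p" by (simp add: orient_sign_def)
  moreover have "list_sign h xs = sign p * list_sign h ys" using list_sign_permute p by metis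
  ultimately show ?thesis using list_sign_square[OF assms(1,3)] by (simp add: mult.assoc)
qed

lemma set_omit_nth:
  assumes "distinct xs" "j < length xs"
  shows "set (omit_nth j xs) = set xs - {xs ! j}" "distinct (omit_nth j xs)"
proof -
  have "distinct (take j xs @ xs ! j # drop (Suc j) xs)"
    "set xs = set (take j xs @ xs ! j # drop (Suc j) xs)"
    using id_take_nth_drop[OF assms(2)] assms(1) by simp_all
  then show "set (omit_nth j xs) = set xs - {xs ! j}" "distinct (omit_nth j xs)"
    by (auto simp: omit_nth_def)
qed

text \<open>Moving the entry at position \<open>j\<close> to the front costs \<open>(-1) ^ j\<close>, the same sign as in the
  boundary map; this is why the position disappears from the incidence number in \<open>incidence_facet\<close>.\<close>

lemma list_sign_omit_nth:
  assumes "distinct xs" "j < length xs"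
  shows "list_sign h xs = (-1) ^ j * comparison_sign h (set xs) (xs ! j) * list_sign h (omit_nth j xs)"
proof -
  have "list_sign h (xs ! j # omit_nth j xs) = (-1) ^ j * list_sign h xs"
    using list_sign_move[of h "xs ! j" "take j xs" "drop (Suc j) xs"] id_take_nth_drop[OF assms(2)] assms(2)
    by (simp add: omit_nth_def)
  moreover have "mset (omit_nth j xs) = mset_set (set xs - {xs ! j})"
    using set_omit_nth[OF assms] by (metis mset_set_set)
  then have "list_sign h (xs ! j # omit_nth j xs) = comparison_sign h (set xs) (xs ! j) * list_sign h (omit_nth j xs)"
    by (simp add: comparison_sign_def prod_unfold_prod_mset)
  ultimately have "(-1) ^ j * ((-1) ^ j * list_sign h xs)
      = (-1) ^ j * (comparison_sign h (set xs) (xs ! j) * list_sign h (omit_nth j xs))"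
    by (simp only:)
  then show ?thesis by (simp only: left_minus_one_mult_self mult.assoc)
qed

lemma abs_comparison_sign:
  assumes "inj_on h \<sigma>" "v \<in> \<sigma>"
  shows "\<bar>comparison_sign h \<sigma> v\<bar> = 1"
  unfolding comparison_sign_def abs_prod
  using assms by (intro prod.neutral) (auto simp: sgn_if inj_on_def)

text \<open>The chosen orientations enter only through one sign per simplex. Up to these signs the incidence
  number is that of the orientation by increasing \<open>h\<close>.\<close>

lemma incidence_facet:
  assumes "orientation X ori" "\<sigma> \<in> X" "\<sigma> - {v} \<in> X" "v \<in> \<sigma>" "inj_on h \<sigma>"
  shows "incidence ori \<sigma> (\<sigma> - {v})
    = list_sign h (ori \<sigma>) * list_sign h (ori (\<sigma> - {v})) * comparison_sign h \<sigma> v"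
proof -
  have d: "distinct (ori \<sigma>)" "set (ori \<sigma>) = \<sigma>" "distinct (ori (\<sigma> - {v}))"
    "set (ori (\<sigma> - {v})) = \<sigma> - {v}" using assms by (auto simp: orientation_def)
  obtain k where k: "k < length (ori \<sigma>)" "ori \<sigma> ! k = v" using d assms(4) by (metis in_set_conv_nth)
  have "set (omit_nth j (ori \<sigma>)) = \<sigma> - {v} \<longleftrightarrow> j = k" if "j < length (ori \<sigma>)" for j
  proof -
    have "ori \<sigma> ! j \<in> \<sigma>" using that d by auto
    then have "set (omit_nth j (ori \<sigma>)) = \<sigma> - {v} \<longleftrightarrow> ori \<sigma> ! j = v"
      using set_omit_nth(1)[OF d(1) that] d(2) by auto
    then show ?thesis using that d(1) k nth_eq_iff_index_eq by metis
  qed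
  then have "incidence ori \<sigma> (\<sigma> - {v}) = (\<Sum>j<length (ori \<sigma>). if j = k
      then (-1) ^ j * orient_sign (omit_nth j (ori \<sigma>)) (ori (\<sigma> - {v})) else 0)"
    unfolding incidence_def by (intro sum.cong) auto
  also have "\<dots> = (-1) ^ k * orient_sign (omit_nth k (ori \<sigma>)) (ori (\<sigma> - {v}))"
    using k by simp
  also have "orient_sign (omit_nth k (ori \<sigma>)) (ori (\<sigma> - {v}))
     = list_sign h (omit_nth k (ori \<sigma>)) * list_sign h (ori (\<sigma> - {v}))"
    using d k assms(5) set_omit_nth[OF d(1) k(1)] by (intro orient_sign_eq) (auto intro: inj_on_subset)
  also have "(-1) ^ k * (list_sign h (omit_nth k (ori \<sigma>)) * list_sign h (ori (\<sigma> - {v})))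
     = list_sign h (ori \<sigma>) * list_sign h (ori (\<sigma> - {v})) * comparison_sign h \<sigma> v"
  proof -
    have "comparison_sign h \<sigma> v * comparison_sign h \<sigma> v = 1"
      using abs_comparison_sign[OF assms(5,4)] by (metis abs_mult_self_eq mult_1)
    moreover have "list_sign h (ori \<sigma>) = (-1) ^ k * comparison_sign h \<sigma> v * list_sign h (omit_nth k (ori \<sigma>))"
      using list_sign_omit_nth[OF d(1) k(1), of h] k d(2) by simp
    moreover have "(s * p * a) * b * p = p * p * (s * (a * b))" for s p a b :: int
      by (simp only: mult_ac)
    ultimately show ?thesis by (simp only: mult_1)
  qed
  finally show ?thesis .
qed

lemma incidence_eq_0:
  assumes "orientation X ori" "\<sigma> \<in> X" "\<nexists>v. v \<in> \<sigma> \<and> \<tau> = \<sigma> - {v}"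
  shows "incidence ori \<sigma> \<tau> = 0"
  unfolding incidence_def
proof (intro sum.neutral ballI)
  fix j assume "j \<in> {..<length (ori \<sigma>)}"
  moreover have "distinct (ori \<sigma>)" "set (ori \<sigma>) = \<sigma>" using assms by (auto simp: orientation_def)
  ultimately have "set (omit_nth j (ori \<sigma>)) \<noteq> \<tau>"
    using set_omit_nth(1)[of "ori \<sigma>" j] assms(3) nth_mem[of j "ori \<sigma>"] by auto
  then show "(if set (omit_nth j (ori \<sigma>)) = \<tau> then (- 1) ^ j * orient_sign (omit_nth j (ori \<sigma>)) (ori \<tau>) else 0) = 0" by simp
qed

lemma abs_incidence_facet:
  assumes "orientation X ori" "\<sigma> \<in> X" "\<sigma> - {v} \<in> X" "v \<in> \<sigma>" "finite \<sigma>"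
  shows "\<bar>incidence ori \<sigma> (\<sigma> - {v})\<bar> = 1"
proof -
  obtain h :: "'a \<Rightarrow> nat" where h: "inj_on h \<sigma>" using finite_imp_inj_to_nat_seg[OF assms(5)] by blast
  have "\<bar>list_sign h (ori \<tau>)\<bar> = 1" if "\<tau> \<in> X" "\<tau> \<subseteq> \<sigma>" for \<tau>
  proof -
    have "list_sign h (ori \<tau>) * list_sign h (ori \<tau>) = 1"
      using that assms(1) inj_on_subset[OF h] by (intro list_sign_square) (auto simp: orientation_def)
    then have "list_sign h (ori \<tau>) = 1 \<or> list_sign h (ori \<tau>) = - 1"
      by (rule pos_zmult_eq_1_iff_lemma)
    then show ?thesis by auto
  qed
  from this[OF assms(2)] this[OF assms(3)] show ?thesis
    unfolding incidence_facet[OF assms(1-4) h] abs_mult abs_comparison_sign[OF h assms(4)] by simp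
qed

text \<open>By \<open>incidence_facet\<close> the signs of the orderings agree on both sides, and the comparison signs differ
  in one factor only: removing \<open>u\<close> while \<open>v\<close> is present compares \<open>v\<close> with \<open>u\<close>, removing \<open>v\<close>
  while \<open>u\<close> is present compares \<open>u\<close> with \<open>v\<close>.\<close>

lemma incidence_boundary_boundary:
  assumes "orientation X ori" "finite \<sigma>" "u \<in> \<sigma>" "v \<in> \<sigma>" "u \<noteq> v"
    "\<sigma> \<in> X" "\<sigma> - {u} \<in> X" "\<sigma> - {v} \<in> X" "\<sigma> - {u} - {v} \<in> X"
  shows "incidence ori \<sigma> (\<sigma> - {u}) * incidence ori (\<sigma> - {u}) (\<sigma> - {u} - {v})
    = - (incidence ori \<sigma> (\<sigma> - {v}) * incidence ori (\<sigma> - {v}) (\<sigma> - {u} - {v}))"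
proof -
  obtain h :: "'a \<Rightarrow> nat" where h: "inj_on h \<sigma>" using finite_imp_inj_to_nat_seg[OF assms(2)] by blast
  have sq: "list_sign h (ori \<tau>) * list_sign h (ori \<tau>) = 1" if "\<tau> \<in> X" "\<tau> \<subseteq> \<sigma>" for \<tau>
    using that assms(1) inj_on_subset[OF h] by (intro list_sign_square) (auto simp: orientation_def)
  have sub: "inj_on h (\<sigma> - {u})" "inj_on h (\<sigma> - {v})" using inj_on_subset[OF h] by blast+
  have comm: "\<sigma> - {u} - {v} = \<sigma> - {v} - {u}" by blast
  have split: "comparison_sign h \<sigma> a = sgn (int (h b) - int (h a)) * comparison_sign h (\<sigma> - {b}) a"
    if "b \<in> \<sigma>" "a \<noteq> b" for a b
    using that assms(2) unfolding comparison_sign_def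
    by (subst prod.remove[of _ b]) (auto intro!: arg_cong2[where f="(*)"] prod.cong)
  have s: "sgn (int (h v) - int (h u)) = - sgn (int (h u) - int (h v))" by (simp add: sgn_if)
  have 1: "incidence ori \<sigma> (\<sigma> - {u}) * incidence ori (\<sigma> - {u}) (\<sigma> - {u} - {v})
     = list_sign h (ori \<sigma>) * list_sign h (ori (\<sigma> - {u} - {v})) * (list_sign h (ori (\<sigma> - {u})) * list_sign h (ori (\<sigma> - {u})))
        * (comparison_sign h \<sigma> u * comparison_sign h (\<sigma> - {u}) v)"
    using assms incidence_facet[OF assms(1) _ _ _ h, of u] incidence_facet[OF assms(1) _ _ _ sub(1), of v]
    by (simp add: mult_ac)
  have 2: "incidence ori \<sigma> (\<sigma> - {v}) * incidence ori (\<sigma> - {v}) (\<sigma> - {u} - {v})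
     = list_sign h (ori \<sigma>) * list_sign h (ori (\<sigma> - {u} - {v})) * (list_sign h (ori (\<sigma> - {v})) * list_sign h (ori (\<sigma> - {v})))
        * (comparison_sign h \<sigma> v * comparison_sign h (\<sigma> - {v}) u)"
    using assms incidence_facet[OF assms(1) _ _ _ h, of v] incidence_facet[OF assms(1) _ _ _ sub(2), of u]
    unfolding comm by (simp add: mult_ac)
  show ?thesis unfolding 1 2 sq[OF assms(7) Diff_subset] sq[OF assms(8) Diff_subset]
    using split[of v u] split[of u v] assms(3-5) s by (simp add: mult_ac)
qed

section \<open>Incidence numbers and the composition of boundary maps\<close>

locale oriented_complex =
  fixes X :: "'a set set" and ori :: "'a set \<Rightarrow> 'a list"
  assumes finite_complex: "finite X"
    and finite_simplex: "\<sigma> \<in> X \<Longrightarrow> finite \<sigma>"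
    and face_closed: "\<sigma> \<in> X \<Longrightarrow> \<tau> \<subseteq> \<sigma> \<Longrightarrow> \<tau> \<in> X"
    and oriented: "orientation X ori"
begin

abbreviation inc :: "'a set \<Rightarrow> 'a set \<Rightarrow> real" where
  "inc \<sigma> \<tau> \<equiv> real_of_int (incidence ori \<sigma> \<tau>)"

lemma finite_simplices: "finite (simplices X k)"
  using finite_complex by (simp add: simplices_def)

lemma facet_eq_Diff:
  assumes "finite \<sigma>" "\<tau> \<subseteq> \<sigma>" "card \<sigma> = card \<tau> + 1"
  obtains v where "v \<in> \<sigma>" "\<tau> = \<sigma> - {v}"
proof -
  have "card (\<sigma> - \<tau>) = 1" using assms by (simp add: card_Diff_subset finite_subset)
  then obtain v where "\<sigma> - \<tau> = {v}" by (rule card_1_singletonE)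
  with assms(2) have "v \<in> \<sigma>" "\<tau> = \<sigma> - {v}" by auto
  then show ?thesis by (rule that)
qed

lemma inc_eq_0:
  assumes "\<sigma> \<in> X" "\<not> (\<tau> \<subseteq> \<sigma> \<and> card \<sigma> = card \<tau> + 1)"
  shows "inc \<sigma> \<tau> = 0"
proof -
  have "\<nexists>v. v \<in> \<sigma> \<and> \<tau> = \<sigma> - {v}"
    using assms(2) card_Suc_Diff1[OF finite_simplex[OF assms(1)]] by auto
  then show ?thesis using incidence_eq_0[OF oriented assms(1)] by simp
qed

lemma abs_inc:
  assumes "\<sigma> \<in> X" "\<tau> \<subseteq> \<sigma>" "card \<sigma> = card \<tau> + 1"
  shows "\<bar>inc \<sigma> \<tau>\<bar> = 1"
proof -
  from assms finite_simplex obtain v where v: "v \<in> \<sigma>" "\<tau> = \<sigma> - {v}" by (blast elim: facet_eq_Diff)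
  have "\<bar>incidence ori \<sigma> \<tau>\<bar> = 1"
    unfolding v(2) using assms v(1) finite_simplex face_closed
    by (intro abs_incidence_facet[OF oriented]) auto
  then show ?thesis by simp
qed

lemma inc_square:
  assumes "\<sigma> \<in> X" "\<tau> \<subseteq> \<sigma>" "card \<sigma> = card \<tau> + 1"
  shows "inc \<sigma> \<tau> * inc \<sigma> \<tau> = 1"
  using abs_inc[OF assms] by (metis abs_mult_self_eq mult_1)

lemma inc_two_facets:
  assumes "\<sigma> \<in> X" "\<tau> \<subseteq> \<sigma>" "\<tau>' \<subseteq> \<sigma>" "card \<sigma> = card \<tau> + 1" "card \<sigma> = card \<tau>' + 1" "\<tau> \<noteq> \<tau>'"
  shows "inc \<sigma> \<tau> * inc \<tau> (\<tau> \<inter> \<tau>') = - (inc \<sigma> \<tau>' * inc \<tau>' (\<tau> \<inter> \<tau>'))"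
proof -
  from assms finite_simplex obtain u where u: "u \<in> \<sigma>" "\<tau> = \<sigma> - {u}" by (blast elim: facet_eq_Diff)
  from assms finite_simplex obtain v where v: "v \<in> \<sigma>" "\<tau>' = \<sigma> - {v}" by (blast elim: facet_eq_Diff)
  have "\<sigma> - {u} - {v} \<in> X" by (rule face_closed[OF assms(1)]) blast
  have "u \<noteq> v" using assms(6) u v by blast
  have meet: "\<tau> \<inter> \<tau>' = \<sigma> - {u} - {v}" using u v by blast
  have "incidence ori \<sigma> (\<sigma> - {u}) * incidence ori (\<sigma> - {u}) (\<sigma> - {u} - {v})
    = - (incidence ori \<sigma> (\<sigma> - {v}) * incidence ori (\<sigma> - {v}) (\<sigma> - {u} - {v}))"
    using assms(1) u(1) v(1) \<open>u \<noteq> v\<close> \<open>\<sigma> - {u} - {v} \<in> X\<close>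
    by (intro incidence_boundary_boundary[OF oriented] finite_simplex
        face_closed[OF assms(1) Diff_subset])
  then show ?thesis unfolding meet unfolding u(2) v(2) by (simp flip: of_int_mult of_int_minus)
qed

text \<open>Only the two facets of \<open>\<sigma>\<close> that contain \<open>\<rho>\<close> contribute, with opposite signs.\<close>

lemma boundary_boundary:
  assumes "\<sigma> \<in> simplices X (Suc k)" "card \<rho> = k"
  shows "(\<Sum>\<tau>\<in>simplices X k. inc \<sigma> \<tau> * inc \<tau> \<rho>) = 0"
proof (cases "\<rho> \<subseteq> \<sigma>")
  case False
  have "inc \<sigma> \<tau> * inc \<tau> \<rho> = 0" if "\<tau> \<in> simplices X k" for \<tau>
    using False inc_eq_0[of \<sigma> \<tau>] inc_eq_0[of \<tau> \<rho>] assms that by (auto simp: simplices_def)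
  then show ?thesis by simp
next
  case True
  have \<sigma>: "\<sigma> \<in> X" "finite \<sigma>" "card \<sigma> = k + 2" using assms finite_simplex by (auto simp: simplices_def)
  then have "card (\<sigma> - \<rho>) = 2" using True assms(2) by (simp add: card_Diff_subset finite_subset)
  then obtain u v where uv: "\<sigma> - \<rho> = {u, v}" "u \<noteq> v" by (auto simp: card_2_iff)
  have faces: "\<sigma> - {u} \<in> simplices X k" "\<sigma> - {v} \<in> simplices X k" "\<sigma> - {u} \<noteq> \<sigma> - {v}"
  proof -
    have "u \<in> \<sigma>" "v \<in> \<sigma>" using uv(1) by auto
    then show "\<sigma> - {u} \<in> simplices X k" "\<sigma> - {v} \<in> simplices X k" "\<sigma> - {u} \<noteq> \<sigma> - {v}"
      using uv(2) \<sigma> face_closed[OF \<sigma>(1)] by (auto simp: simplices_def)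
  qed
  have "inc \<sigma> \<tau> * inc \<tau> \<rho> = 0" if "\<tau> \<in> simplices X k - {\<sigma> - {u}, \<sigma> - {v}}" for \<tau>
  proof (rule ccontr)
    assume *: "inc \<sigma> \<tau> * inc \<tau> \<rho> \<noteq> 0"
    then have "\<tau> \<subseteq> \<sigma>" "\<rho> \<subseteq> \<tau>" "card \<sigma> = card \<tau> + 1"
      using inc_eq_0[of \<sigma> \<tau>] inc_eq_0[of \<tau> \<rho>] \<sigma> that by (auto simp: simplices_def)
    with \<sigma>(2) obtain w where "w \<in> \<sigma>" "\<tau> = \<sigma> - {w}" by (blast elim: facet_eq_Diff)
    with uv(1) \<open>\<rho> \<subseteq> \<tau>\<close> that show False by auto
  qed
  then have "(\<Sum>\<tau>\<in>simplices X k. inc \<sigma> \<tau> * inc \<tau> \<rho>)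
      = (\<Sum>\<tau>\<in>{\<sigma> - {u}, \<sigma> - {v}}. inc \<sigma> \<tau> * inc \<tau> \<rho>)"
    using faces by (intro sum.mono_neutral_right finite_simplices) auto
  also have "\<dots> = 0"
  proof -
    have "(\<sigma> - {u}) \<inter> (\<sigma> - {v}) = \<rho>" using uv True by blast
    then show ?thesis
      using inc_two_facets[of \<sigma> "\<sigma> - {u}" "\<sigma> - {v}"] faces \<sigma> by (simp add: simplices_def)
  qed
  finally show ?thesis .
qed

section \<open>The Hodge Laplacian\<close>

text \<open>The matrix entry of the Hodge Laplacian in dimension \<open>k \<ge> 1\<close>, the sum of the up-Laplacian and the
  down-Laplacian.\<close>

definition hodge_entry :: "nat \<Rightarrow> 'a set \<Rightarrow> 'a set \<Rightarrow> real" where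
  "hodge_entry k \<tau> \<tau>' = (\<Sum>\<sigma>\<in>simplices X (Suc k). inc \<sigma> \<tau> * inc \<sigma> \<tau>')
     + (\<Sum>\<rho>\<in>simplices X (k - 1). inc \<tau> \<rho> * inc \<tau>' \<rho>)"

lemma hodge_entry_diagonal:
  assumes "\<tau> \<in> simplices X k" "k \<ge> 1"
  shows "hodge_entry k \<tau> \<tau> = real (simplex_degree X k \<tau>) + real (k + 1)"
proof -
  have \<tau>: "\<tau> \<in> X" "finite \<tau>" "card \<tau> = k + 1" using assms finite_simplex by (auto simp: simplices_def)
  have "(\<Sum>\<sigma>\<in>simplices X (Suc k). inc \<sigma> \<tau> * inc \<sigma> \<tau>)
      = (\<Sum>\<sigma>\<in>simplices X (Suc k). if \<tau> \<subseteq> \<sigma> then 1 else 0)"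
    using \<tau> by (intro sum.cong refl) (auto simp: simplices_def inc_square inc_eq_0)
  also have "\<dots> = real (simplex_degree X k \<tau>)"
    using finite_simplices by (simp add: simplex_degree_def sum.If_cases Int_def)
  finally have up: "(\<Sum>\<sigma>\<in>simplices X (Suc k). inc \<sigma> \<tau> * inc \<sigma> \<tau>) = real (simplex_degree X k \<tau>)" .
  have "(\<Sum>\<rho>\<in>simplices X (k - 1). inc \<tau> \<rho> * inc \<tau> \<rho>)
      = (\<Sum>\<rho>\<in>simplices X (k - 1). if \<rho> \<subseteq> \<tau> then 1 else 0)"
    using \<tau> assms(2) by (intro sum.cong refl) (auto simp: simplices_def inc_square inc_eq_0)
  also have "\<dots> = real (card {\<rho> \<in> simplices X (k - 1). \<rho> \<subseteq> \<tau>})"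
    using finite_simplices by (simp add: sum.If_cases Int_def)
  also have "{\<rho> \<in> simplices X (k - 1). \<rho> \<subseteq> \<tau>} = {\<rho>. \<rho> \<subseteq> \<tau> \<and> card \<rho> = k}"
    using assms(2) face_closed[OF \<tau>(1)] by (auto simp: simplices_def)
  also have "card \<dots> = k + 1"
    using n_subsets[OF \<tau>(2), of k] \<tau>(3) by simp
  finally show ?thesis unfolding hodge_entry_def up by simp
qed

text \<open>Two different \<open>k\<close>-simplices have at most one common coface \<open>\<tau> \<union> \<tau>'\<close> and at most one common facet
  \<open>\<tau> \<inter> \<tau>'\<close>, so each of the two sums has at most one nonzero term, and the down-term requires that
  the intersection has \<open>k\<close> elements. If the coface is present, so is the facet, and
  \<open>inc_two_facets\<close> makes the two terms cancel.\<close>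

lemma hodge_entry_off_diagonal:
  assumes "\<tau> \<in> simplices X k" "\<tau>' \<in> simplices X k" "\<tau> \<noteq> \<tau>'" "k \<ge> 1"
  shows "\<bar>hodge_entry k \<tau> \<tau>'\<bar>
    \<le> (if \<tau> \<union> \<tau>' \<notin> X \<and> card (\<tau> \<inter> \<tau>') = k then 1 else 0)"
proof -
  have \<tau>: "\<tau> \<in> X" "finite \<tau>" "card \<tau> = k + 1" "\<tau>' \<in> X" "finite \<tau>'" "card \<tau>' = k + 1"
    using assms finite_simplex by (auto simp: simplices_def)
  have union: "card (\<tau> \<union> \<tau>') + card (\<tau> \<inter> \<tau>') = 2 * k + 2" using card_Un_Int[of \<tau> \<tau>'] \<tau> by simp
  have "\<not> \<tau> \<subseteq> \<tau>'" using card_subset_eq[OF \<tau>(5)] \<tau>(3,6) assms(3) by auto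
  then have "card (\<tau> \<inter> \<tau>') < card \<tau>" by (intro psubset_card_mono[OF \<tau>(2)]) blast
  then have le: "card (\<tau> \<inter> \<tau>') \<le> k" using \<tau> by simp
  have sig: "\<sigma> = \<tau> \<union> \<tau>'" if "\<sigma> \<in> simplices X (Suc k)" "\<tau> \<union> \<tau>' \<subseteq> \<sigma>" for \<sigma>
  proof -
    have "finite \<sigma>" "card \<sigma> \<le> card (\<tau> \<union> \<tau>')" using that union le finite_simplex by (auto simp: simplices_def)
    with that(2) show ?thesis by (intro card_seteq[symmetric])
  qed
  have rho: "\<rho> = \<tau> \<inter> \<tau>'" if "\<rho> \<in> simplices X (k - 1)" "\<rho> \<subseteq> \<tau> \<inter> \<tau>'" for \<rho>
  proof (rule card_seteq[OF _ that(2)])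
    show "card (\<tau> \<inter> \<tau>') \<le> card \<rho>" using that(1) le assms(4) by (simp add: simplices_def)
  qed (use \<tau>(2) in simp)
  have "(\<Sum>\<sigma>\<in>simplices X (Suc k). inc \<sigma> \<tau> * inc \<sigma> \<tau>') = (\<Sum>\<sigma>\<in>simplices X (Suc k).
      if \<sigma> = \<tau> \<union> \<tau>' then inc (\<tau> \<union> \<tau>') \<tau> * inc (\<tau> \<union> \<tau>') \<tau>' else 0)"
  proof (rule sum.cong[OF refl])
    fix \<sigma> assume \<sigma>: "\<sigma> \<in> simplices X (Suc k)"
    show "inc \<sigma> \<tau> * inc \<sigma> \<tau>' = (if \<sigma> = \<tau> \<union> \<tau>' then inc (\<tau> \<union> \<tau>') \<tau> * inc (\<tau> \<union> \<tau>') \<tau>' else 0)"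
    proof (cases "\<sigma> = \<tau> \<union> \<tau>'")
      case False
      then have "\<not> \<tau> \<subseteq> \<sigma> \<or> \<not> \<tau>' \<subseteq> \<sigma>" using sig[OF \<sigma>] by blast
      then show ?thesis
        using False inc_eq_0[of \<sigma> \<tau>] inc_eq_0[of \<sigma> \<tau>'] \<sigma> by (auto simp: simplices_def)
    qed simp
  qed
  then have up: "(\<Sum>\<sigma>\<in>simplices X (Suc k). inc \<sigma> \<tau> * inc \<sigma> \<tau>') =
      (if \<tau> \<union> \<tau>' \<in> simplices X (Suc k) then inc (\<tau> \<union> \<tau>') \<tau> * inc (\<tau> \<union> \<tau>') \<tau>' else 0)"
    using finite_simplices by simp
  have "(\<Sum>\<rho>\<in>simplices X (k - 1). inc \<tau> \<rho> * inc \<tau>' \<rho>) = (\<Sum>\<rho>\<in>simplices X (k - 1).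
      if \<rho> = \<tau> \<inter> \<tau>' then inc \<tau> (\<tau> \<inter> \<tau>') * inc \<tau>' (\<tau> \<inter> \<tau>') else 0)"
  proof (rule sum.cong[OF refl])
    fix \<rho> assume \<rho>: "\<rho> \<in> simplices X (k - 1)"
    show "inc \<tau> \<rho> * inc \<tau>' \<rho> = (if \<rho> = \<tau> \<inter> \<tau>' then inc \<tau> (\<tau> \<inter> \<tau>') * inc \<tau>' (\<tau> \<inter> \<tau>') else 0)"
    proof (cases "\<rho> = \<tau> \<inter> \<tau>'")
      case False
      then have "\<not> \<rho> \<subseteq> \<tau> \<or> \<not> \<rho> \<subseteq> \<tau>'" using rho[OF \<rho>] by blast
      then show ?thesis
        using False inc_eq_0[OF \<tau>(1), of \<rho>] inc_eq_0[OF \<tau>(4), of \<rho>] by auto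
    qed simp
  qed
  then have down: "(\<Sum>\<rho>\<in>simplices X (k - 1). inc \<tau> \<rho> * inc \<tau>' \<rho>) =
      (if \<tau> \<inter> \<tau>' \<in> simplices X (k - 1) then inc \<tau> (\<tau> \<inter> \<tau>') * inc \<tau>' (\<tau> \<inter> \<tau>') else 0)"
    using finite_simplices by simp
  have meet: "\<tau> \<inter> \<tau>' \<in> simplices X (k - 1) \<longleftrightarrow> card (\<tau> \<inter> \<tau>') = k"
    using face_closed[OF \<tau>(1), of "\<tau> \<inter> \<tau>'"] assms(4) by (auto simp: simplices_def)
  have join: "\<tau> \<union> \<tau>' \<in> simplices X (Suc k) \<longleftrightarrow> \<tau> \<union> \<tau>' \<in> X \<and> card (\<tau> \<inter> \<tau>') = k"
    using union by (auto simp: simplices_def)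
  show ?thesis
  proof (cases "card (\<tau> \<inter> \<tau>') = k")
    case False
    then show ?thesis unfolding hodge_entry_def up down meet join by simp
  next
    case k: True
    let ?c = "inc \<tau> (\<tau> \<inter> \<tau>')" and ?d = "inc \<tau>' (\<tau> \<inter> \<tau>')"
    have cd: "\<bar>?c\<bar> = 1" "\<bar>?d\<bar> = 1" using \<tau> k by (auto intro!: abs_inc)
    show ?thesis
    proof (cases "\<tau> \<union> \<tau>' \<in> X")
      case False
      then show ?thesis unfolding hodge_entry_def up down meet join using k cd by (simp add: abs_mult)
    next
      case True
      let ?a = "inc (\<tau> \<union> \<tau>') \<tau>" and ?b = "inc (\<tau> \<union> \<tau>') \<tau>'"
      have card: "card (\<tau> \<union> \<tau>') = k + 2" using union k by simp
      have "?a * ?c = - (?b * ?d)"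
        using inc_two_facets[of "\<tau> \<union> \<tau>'" \<tau> \<tau>'] True card \<tau> assms(3) by auto
      moreover have "?b * ?b = 1" "?c * ?c = 1"
        using True card \<tau> k by (auto intro!: inc_square)
      \<comment> \<open>multiply \<open>?a * ?c + ?b * ?d = 0\<close> by \<open>?b * ?c\<close> and drop the squares\<close>
      moreover have "?a * ?b * (?c * ?c) = ?a * ?c * (?b * ?c)" by (simp only: mult_ac)
      moreover have "?b * ?d * (?b * ?c) = ?b * ?b * (?c * ?d)" by (simp only: mult_ac)
      ultimately have "?a * ?b + ?c * ?d = 0" by simp
      then show ?thesis unfolding hodge_entry_def up down meet join using True k by simp
    qed
  qed
qed

text \<open>Each of the simplices counted spans with \<open>\<tau>\<close> exactly one coface of \<open>\<tau>\<close>, and every coface of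
  \<open>\<tau>\<close> has \<open>k + 1\<close> facets besides \<open>\<tau>\<close>.\<close>

lemma card_up_neighbours:
  assumes "\<tau> \<in> simplices X k"
  shows "card {\<tau>' \<in> simplices X k. \<tau>' \<noteq> \<tau> \<and> \<tau>' \<union> \<tau> \<in> simplices X (Suc k)}
    = (k + 1) * simplex_degree X k \<tau>"
proof -
  let ?U = "{\<sigma> \<in> simplices X (Suc k). \<tau> \<subseteq> \<sigma>}"
  let ?F = "\<lambda>\<sigma>. {\<tau>'. \<tau>' \<subseteq> \<sigma> \<and> card \<tau>' = k + 1} - {\<tau>}"
  have \<tau>: "finite \<tau>" "card \<tau> = k + 1" using assms finite_simplex by (auto simp: simplices_def)
  have union: "\<tau>' \<union> \<tau> = \<sigma>" if "\<sigma> \<in> ?U" "\<tau>' \<in> ?F \<sigma>" for \<sigma> \<tau>'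
  proof -
    have \<sigma>: "finite \<sigma>" "card \<sigma> = k + 2" using that finite_simplex by (auto simp: simplices_def)
    have fin: "finite \<tau>'" using that \<sigma>(1) by (auto intro: finite_subset)
    have "\<not> \<tau>' \<subseteq> \<tau>" using that \<tau> card_subset_eq[OF \<tau>(1), of \<tau>'] by auto
    then have "card \<tau> < card (\<tau>' \<union> \<tau>)" using \<tau>(1) fin by (intro psubset_card_mono) auto
    then show ?thesis using that \<sigma> \<tau> by (intro card_seteq) auto
  qed
  have "{\<tau>' \<in> simplices X k. \<tau>' \<noteq> \<tau> \<and> \<tau>' \<union> \<tau> \<in> simplices X (Suc k)} = (\<Union>\<sigma>\<in>?U. ?F \<sigma>)"
    (is "?N = _")
  proof (rule equalityI; rule subsetI)
    fix \<tau>' assume "\<tau>' \<in> ?N"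
    then show "\<tau>' \<in> (\<Union>\<sigma>\<in>?U. ?F \<sigma>)"
      by (intro UN_I[of "\<tau>' \<union> \<tau>"]) (auto simp: simplices_def)
  next
    fix \<tau>' assume "\<tau>' \<in> (\<Union>\<sigma>\<in>?U. ?F \<sigma>)"
    then obtain \<sigma> where \<sigma>: "\<sigma> \<in> ?U" "\<tau>' \<in> ?F \<sigma>" by blast
    then have "\<tau>' \<in> X" using face_closed[of \<sigma> \<tau>'] by (auto simp: simplices_def)
    then show "\<tau>' \<in> ?N" using \<sigma> union[OF \<sigma>] by (auto simp: simplices_def)
  qed
  also have "card \<dots> = (\<Sum>\<sigma>\<in>?U. card (?F \<sigma>))"
  proof (rule card_UN_disjoint)
    show "finite ?U" using finite_simplices by simp
    show "\<forall>\<sigma>\<in>?U. finite (?F \<sigma>)" using finite_simplex by (auto simp: simplices_def)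
    show "\<forall>\<sigma>\<in>?U. \<forall>\<sigma>'\<in>?U. \<sigma> \<noteq> \<sigma>' \<longrightarrow> ?F \<sigma> \<inter> ?F \<sigma>' = {}"
    proof (intro ballI impI equals0I)
      fix \<sigma> \<sigma>' \<tau>'
      assume *: "\<sigma> \<in> ?U" "\<sigma>' \<in> ?U" "\<sigma> \<noteq> \<sigma>'" "\<tau>' \<in> ?F \<sigma> \<inter> ?F \<sigma>'"
      show False
        using union[OF *(1) IntD1[OF *(4)]] union[OF *(2) IntD2[OF *(4)]] *(3) by simp
    qed
  qed
  also have "\<dots> = (\<Sum>\<sigma>\<in>?U. k + 1)"
  proof (rule sum.cong[OF refl])
    fix \<sigma> assume \<sigma>: "\<sigma> \<in> ?U"
    then have "finite \<sigma>" "card \<sigma> = k + 2" using finite_simplex by (auto simp: simplices_def)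
    then have "card {\<tau>'. \<tau>' \<subseteq> \<sigma> \<and> card \<tau>' = k + 1} = k + 2"
      using n_subsets[of \<sigma> "k + 1"] by simp
    then show "card (?F \<sigma>) = k + 1" using \<sigma> \<tau> by (subst card_Diff_singleton) auto
  qed
  finally show ?thesis by (simp add: simplex_degree_def)
qed

lemma conj_degree_partition:
  assumes "\<tau> \<in> simplices X k" "simplex_degree X k \<tau> \<ge> 1"
  shows "conj_degree X k 1 = 1 + (k + 1) * simplex_degree X k \<tau>
    + card {\<tau>' \<in> simplices X k. simplex_degree X k \<tau>' \<ge> 1 \<and> \<tau>' \<noteq> \<tau> \<and> \<tau>' \<union> \<tau> \<notin> simplices X (Suc k)}"
    (is "_ = _ + card ?R")
proof -
  let ?N = "{\<tau>' \<in> simplices X k. \<tau>' \<noteq> \<tau> \<and> \<tau>' \<union> \<tau> \<in> simplices X (Suc k)}"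
  have "simplex_degree X k \<tau>' \<ge> 1" if "\<tau>' \<union> \<tau> \<in> simplices X (Suc k)" for \<tau>'
    unfolding simplex_degree_def using that finite_simplices[of "Suc k"]
    by (auto simp: Suc_le_eq card_gt_0_iff)
  then have "{\<tau>' \<in> simplices X k. simplex_degree X k \<tau>' \<ge> 1} = insert \<tau> (?N \<union> ?R)"
    using assms by auto
  moreover have "card (insert \<tau> (?N \<union> ?R)) = Suc (card ?N + card ?R)"
    using finite_simplices by (subst card_insert_disjoint) (auto intro!: card_Un_disjoint)
  ultimately show ?thesis using card_up_neighbours[OF assms(1)] by (simp add: conj_degree_def)
qed

text \<open>Gershgorin's estimate in the row of the Hodge Laplacian at which \<open>|y|\<close> is largest. Since \<open>y\<close>
  vanishes on simplices of degree zero, the estimate counts only columns of positive degree; this is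
  how the conjugate degree enters.\<close>

lemma hodge_gershgorin:
  assumes "k \<ge> 1" "\<mu> > 0" "\<tau>1 \<in> simplices X k" "y \<tau>1 \<noteq> 0"
    and eigen: "\<And>\<tau>. \<tau> \<in> simplices X k \<Longrightarrow>
      (\<Sum>\<sigma>\<in>simplices X (Suc k). inc \<sigma> \<tau> * (\<Sum>\<tau>'\<in>simplices X k. inc \<sigma> \<tau>' * y \<tau>')) = \<mu> * y \<tau>"
  obtains \<tau> where "\<tau> \<in> simplices X k" "simplex_degree X k \<tau> \<ge> 1"
    "\<mu> \<le> real (simplex_degree X k \<tau>) + real (k + 1)
       + real (card {\<tau>' \<in> simplices X k. simplex_degree X k \<tau>' \<ge> 1 \<and> \<tau>' \<noteq> \<tau>
           \<and> \<tau>' \<union> \<tau> \<notin> X \<and> card (\<tau>' \<inter> \<tau>) = k})"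
proof -
  let ?S = "simplices X (Suc k)" and ?T = "simplices X k" and ?R = "simplices X (k - 1)"
  note fin [simp] = finite_simplices
  define z where "z \<sigma> = (\<Sum>\<tau>'\<in>?T. inc \<sigma> \<tau>' * y \<tau>')" for \<sigma>
  have eig: "(\<Sum>\<sigma>\<in>?S. inc \<sigma> \<tau> * z \<sigma>) = \<mu> * y \<tau>" if "\<tau> \<in> ?T" for \<tau>
    using eigen[OF that] by (simp add: z_def)
  \<comment> \<open>\<open>y\<close> is a boundary, hence a cycle\<close>
  have cycle: "(\<Sum>\<tau>\<in>?T. inc \<tau> \<rho> * y \<tau>) = 0" if "\<rho> \<in> ?R" for \<rho>
  proof -
    have "\<mu> * (\<Sum>\<tau>\<in>?T. inc \<tau> \<rho> * y \<tau>) = (\<Sum>\<tau>\<in>?T. inc \<tau> \<rho> * (\<Sum>\<sigma>\<in>?S. inc \<sigma> \<tau> * z \<sigma>))"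
      unfolding sum_distrib_left[of \<mu>] by (intro sum.cong refl) (simp add: eig mult.left_commute)
    also have "\<dots> = (\<Sum>\<tau>\<in>?T. \<Sum>\<sigma>\<in>?S. z \<sigma> * (inc \<sigma> \<tau> * inc \<tau> \<rho>))"
      by (simp add: sum_distrib_left mult_ac)
    also have "\<dots> = (\<Sum>\<sigma>\<in>?S. z \<sigma> * (\<Sum>\<tau>\<in>?T. inc \<sigma> \<tau> * inc \<tau> \<rho>))"
      by (subst sum.swap) (simp add: sum_distrib_left)
    also have "\<dots> = 0"
    proof -
      have "card \<rho> = k" using that assms(1) by (simp add: simplices_def)
      then show ?thesis by (simp add: boundary_boundary)
    qed
    finally show ?thesis using assms(2) by simp
  qed
  have uncovered: "y \<tau> = 0" if "\<tau> \<in> ?T" "\<not> simplex_degree X k \<tau> \<ge> 1" for \<tau>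
  proof -
    have "{F \<in> ?S. \<tau> \<subseteq> F} = {}" using that(2) by (simp add: simplex_degree_def Suc_le_eq card_gt_0_iff)
    then have "inc \<sigma> \<tau> = 0" if "\<sigma> \<in> ?S" for \<sigma>
      using that inc_eq_0[of \<sigma> \<tau>] by (auto simp: simplices_def)
    then have "\<mu> * y \<tau> = 0" using eig[OF that(1)] by simp
    then show ?thesis using assms(2) by simp
  qed
  \<comment> \<open>the down-Laplacian kills the cycle \<open>y\<close>, so its terms may be added freely\<close>
  have hodge: "\<mu> * y \<tau> = (\<Sum>\<tau>'\<in>?T. hodge_entry k \<tau> \<tau>' * y \<tau>')" if "\<tau> \<in> ?T" for \<tau>
  proof -
    have "\<mu> * y \<tau> = (\<Sum>\<sigma>\<in>?S. inc \<sigma> \<tau> * z \<sigma>) + (\<Sum>\<rho>\<in>?R. inc \<tau> \<rho> * (\<Sum>\<tau>'\<in>?T. inc \<tau>' \<rho> * y \<tau>'))"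
      using eig[OF that] cycle by simp
    also have "(\<Sum>\<sigma>\<in>?S. inc \<sigma> \<tau> * z \<sigma>) = (\<Sum>\<tau>'\<in>?T. (\<Sum>\<sigma>\<in>?S. inc \<sigma> \<tau> * inc \<sigma> \<tau>') * y \<tau>')"
      unfolding z_def sum_distrib_left sum_distrib_right by (subst sum.swap) (simp add: mult_ac)
    also have "(\<Sum>\<rho>\<in>?R. inc \<tau> \<rho> * (\<Sum>\<tau>'\<in>?T. inc \<tau>' \<rho> * y \<tau>'))
       = (\<Sum>\<tau>'\<in>?T. (\<Sum>\<rho>\<in>?R. inc \<tau> \<rho> * inc \<tau>' \<rho>) * y \<tau>')"
      unfolding sum_distrib_left sum_distrib_right by (subst sum.swap) (simp add: mult_ac)
    finally show ?thesis by (simp add: hodge_entry_def sum.distrib distrib_right)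
  qed
  have range: "finite ((\<lambda>\<tau>. \<bar>y \<tau>\<bar>) ` ?T)" "(\<lambda>\<tau>. \<bar>y \<tau>\<bar>) ` ?T \<noteq> {}" using assms(3) by auto
  from Max_in[OF this] obtain \<tau>
    where \<tau>: "\<tau> \<in> ?T" and "Max ((\<lambda>\<tau>. \<bar>y \<tau>\<bar>) ` ?T) = \<bar>y \<tau>\<bar>" by blast
  then have max: "\<bar>y \<tau>'\<bar> \<le> \<bar>y \<tau>\<bar>" if "\<tau>' \<in> ?T" for \<tau>'
    using Max_ge[OF range(1)] that by force
  have pos: "\<bar>y \<tau>\<bar> > 0" using max[OF assms(3)] assms(4) by linarith
  then have deg: "simplex_degree X k \<tau> \<ge> 1" using uncovered[OF \<tau>] by auto
  let ?P = "{\<tau>' \<in> ?T. simplex_degree X k \<tau>' \<ge> 1 \<and> \<tau>' \<noteq> \<tau> \<and> \<tau>' \<union> \<tau> \<notin> X \<and> card (\<tau>' \<inter> \<tau>) = k}"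
  have "\<mu> * \<bar>y \<tau>\<bar> = \<bar>\<Sum>\<tau>'\<in>?T. hodge_entry k \<tau> \<tau>' * y \<tau>'\<bar>"
    using hodge[OF \<tau>] assms(2) abs_mult[of \<mu> "y \<tau>"] by simp
  also have "\<dots> \<le> (\<Sum>\<tau>'\<in>?T. \<bar>hodge_entry k \<tau> \<tau>'\<bar> * \<bar>y \<tau>'\<bar>)"
    by (simp add: sum_abs flip: abs_mult)
  also have "\<dots> = \<bar>hodge_entry k \<tau> \<tau>\<bar> * \<bar>y \<tau>\<bar> + (\<Sum>\<tau>'\<in>?T - {\<tau>}. \<bar>hodge_entry k \<tau> \<tau>'\<bar> * \<bar>y \<tau>'\<bar>)"
    using \<tau> by (simp add: sum.remove)
  also have "(\<Sum>\<tau>'\<in>?T - {\<tau>}. \<bar>hodge_entry k \<tau> \<tau>'\<bar> * \<bar>y \<tau>'\<bar>)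
      \<le> (\<Sum>\<tau>'\<in>?T - {\<tau>}. (if \<tau>' \<in> ?P then 1 else 0) * \<bar>y \<tau>\<bar>)"
  proof (rule sum_mono)
    fix \<tau>' assume \<tau>': "\<tau>' \<in> ?T - {\<tau>}"
    show "\<bar>hodge_entry k \<tau> \<tau>'\<bar> * \<bar>y \<tau>'\<bar> \<le> (if \<tau>' \<in> ?P then 1 else 0) * \<bar>y \<tau>\<bar>"
    proof (cases "simplex_degree X k \<tau>' \<ge> 1")
      case False
      then show ?thesis using uncovered \<tau>' by simp
    next
      case True
      have "\<bar>hodge_entry k \<tau> \<tau>'\<bar> \<le> (if \<tau> \<union> \<tau>' \<notin> X \<and> card (\<tau> \<inter> \<tau>') = k then 1 else 0)"
        using \<tau>' assms(1) by (intro hodge_entry_off_diagonal[OF \<tau>]) auto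
      also have "\<tau> \<union> \<tau>' \<notin> X \<and> card (\<tau> \<inter> \<tau>') = k \<longleftrightarrow> \<tau>' \<in> ?P"
        using True \<tau>' by (simp add: Un_commute Int_commute)
      finally have "\<bar>hodge_entry k \<tau> \<tau>'\<bar> \<le> (if \<tau>' \<in> ?P then 1 else 0)" .
      then show ?thesis using max \<tau>' by (intro mult_mono) auto
    qed
  qed
  also have "(\<Sum>\<tau>'\<in>?T - {\<tau>}. (if \<tau>' \<in> ?P then 1 else 0) * \<bar>y \<tau>\<bar>) = real (card ?P) * \<bar>y \<tau>\<bar>"
  proof -
    have "(\<Sum>\<tau>'\<in>?T - {\<tau>}. if \<tau>' \<in> ?P then 1 else 0 :: real) = (\<Sum>\<tau>'\<in>?P. 1)"
      by (intro sum.mono_neutral_cong_right) auto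
    also have "\<dots> = real (card ?P)" by simp
    finally show ?thesis by (simp only: sum_distrib_right[symmetric])
  qed
  finally have "\<mu> * \<bar>y \<tau>\<bar> \<le> (real (simplex_degree X k \<tau>) + real (k + 1) + real (card ?P)) * \<bar>y \<tau>\<bar>"
    using hodge_entry_diagonal[OF \<tau> assms(1)] by (simp add: distrib_right)
  then have "\<mu> \<le> real (simplex_degree X k \<tau>) + real (k + 1) + real (card ?P)"
    using pos by (simp add: mult_le_cancel_right)
  with \<tau> deg show ?thesis by (rule that)
qed

text \<open>Let \<open>\<sigma>\<close> be the only coface of \<open>\<tau>\<close>, and suppose that \<open>\<sigma>'\<close> is another \<open>(k + 1)\<close>-simplex, with
  a vertex \<open>b\<close> outside \<open>\<sigma>\<close>. Every facet of \<open>\<sigma>'\<close> through \<open>b\<close> must then lie in \<open>\<tau>\<close> apart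
  from \<open>b\<close>. As \<open>\<sigma>'\<close> has at least two vertices besides \<open>b\<close>, these facets together cover all of
  \<open>\<sigma>' - {b}\<close>, so \<open>\<sigma>' - {b} = \<tau>\<close> and \<open>\<sigma>'\<close> would be a second coface of \<open>\<tau>\<close>.\<close>

lemma unique_simplex:
  assumes "k \<ge> 1" "\<tau> \<in> simplices X k" "simplex_degree X k \<tau> = 1"
    and close: "\<And>\<tau>'. \<tau>' \<in> simplices X k \<Longrightarrow> simplex_degree X k \<tau>' \<ge> 1 \<Longrightarrow> \<tau>' \<noteq> \<tau>
      \<Longrightarrow> \<tau>' \<union> \<tau> \<notin> simplices X (Suc k) \<Longrightarrow> card (\<tau>' \<inter> \<tau>) = k"
  shows "card (simplices X (Suc k)) = 1"
proof -
  let ?S = "simplices X (Suc k)"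
  have \<tau>: "finite \<tau>" "card \<tau> = k + 1" using assms(2) finite_simplex by (auto simp: simplices_def)
  obtain \<sigma> where \<sigma>: "{F \<in> ?S. \<tau> \<subseteq> F} = {\<sigma>}"
    using assms(3) by (auto simp: simplex_degree_def card_1_singleton_iff)
  have "\<sigma>' = \<sigma>" if \<sigma>': "\<sigma>' \<in> ?S" for \<sigma>'
  proof (rule ccontr)
    assume "\<sigma>' \<noteq> \<sigma>"
    have \<sigma>1: "finite \<sigma>" "card \<sigma> = k + 2" using \<sigma> finite_simplex by (auto simp: simplices_def)
    have \<sigma>2: "\<sigma>' \<in> X" "finite \<sigma>'" "card \<sigma>' = k + 2" using \<sigma>' finite_simplex by (auto simp: simplices_def)
    have "\<not> \<sigma>' \<subseteq> \<sigma>" using \<open>\<sigma>' \<noteq> \<sigma>\<close> \<sigma>1 \<sigma>2 card_subset_eq by metis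
    then obtain b where b: "b \<in> \<sigma>'" "b \<notin> \<sigma>" by blast
    then have "b \<notin> \<tau>" using \<sigma> by blast
    have facet: "\<sigma>' - {v} - {b} \<subseteq> \<tau>" if v: "v \<in> \<sigma>'" "v \<noteq> b" for v
    proof -
      have "\<sigma>' - {v} \<in> simplices X k"
        using v \<sigma>2 face_closed[OF \<sigma>2(1)] by (auto simp: simplices_def)
      moreover have "simplex_degree X k (\<sigma>' - {v}) \<ge> 1"
        using \<sigma>' finite_simplices[of "Suc k"] by (auto simp: simplex_degree_def Suc_le_eq card_gt_0_iff)
      moreover have "\<sigma>' - {v} \<noteq> \<tau>" using b v \<open>b \<notin> \<tau>\<close> by blast
      moreover have "(\<sigma>' - {v}) \<union> \<tau> \<notin> ?S"
      proof
        assume "(\<sigma>' - {v}) \<union> \<tau> \<in> ?S"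
        then have "(\<sigma>' - {v}) \<union> \<tau> \<in> {F \<in> ?S. \<tau> \<subseteq> F}" by blast
        then have "(\<sigma>' - {v}) \<union> \<tau> = \<sigma>" unfolding \<sigma> by (rule singletonD)
        then show False using b v by blast
      qed
      ultimately have "card ((\<sigma>' - {v}) \<inter> \<tau>) = k" by (rule close)
      moreover have "(\<sigma>' - {v}) \<inter> \<tau> \<subseteq> \<sigma>' - {v} - {b}" using \<open>b \<notin> \<tau>\<close> by blast
      moreover have "card (\<sigma>' - {v} - {b}) = k" using v b \<sigma>2 by simp
      ultimately have "(\<sigma>' - {v}) \<inter> \<tau> = \<sigma>' - {v} - {b}" using \<sigma>2(2) by (intro card_subset_eq) auto
      then show ?thesis by blast
    qed
    have card: "card (\<sigma>' - {b}) = k + 1" using b \<sigma>2 by simp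
    have "\<sigma>' - {b} \<subseteq> \<tau>"
    proof
      fix e assume e: "e \<in> \<sigma>' - {b}"
      then have "card (\<sigma>' - {b} - {e}) = k" using card \<sigma>2(2) by simp
      \<comment> \<open>for \<open>k = 0\<close> this set is empty: two edges of a graph can share an end point\<close>
      then have "\<sigma>' - {b} - {e} \<noteq> {}" using assms(1) by force
      then obtain v where "v \<in> \<sigma>'" "v \<noteq> b" "v \<noteq> e" by blast
      then show "e \<in> \<tau>" using facet[of v] e by blast
    qed
    then have "\<sigma>' - {b} = \<tau>" using card \<tau> by (intro card_subset_eq) auto
    then have "\<tau> \<subseteq> \<sigma>'" by blast
    then have "\<sigma>' \<in> {F \<in> ?S. \<tau> \<subseteq> F}" using \<sigma>' by blast
    then show False unfolding \<sigma> using \<open>\<sigma>' \<noteq> \<sigma>\<close> by blast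
  qed
  moreover have "\<sigma> \<in> ?S" using \<sigma> by blast
  ultimately have "?S = {\<sigma>}" by blast
  then show ?thesis by simp
qed

end

section \<open>Matrices and spectra\<close>

lemma up_laplacian_carrier [simp]:
  "up_laplacian ori X k \<in> carrier_mat (card (simplices X k)) (card (simplices X k))"
  unfolding up_laplacian_def
  by (rule mult_carrier_mat[of _ _ "card (simplices X (k + 1))"])
    (simp_all add: boundary_matrix_def)

text \<open>Rewriting the eigenvalue equation over the simplices themselves makes the numbering of rows and
  columns disappear from all later arguments.\<close>

lemma eigenvalue_up_laplacian_iff:
  assumes "finite X"
  shows "eigenvalue (up_laplacian ori X k) \<mu> \<longleftrightarrow>
    (\<exists>y. (\<exists>\<tau>\<in>simplices X k. y \<tau> \<noteq> 0) \<and>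
      (\<forall>\<tau>\<in>simplices X k.
        (\<Sum>\<sigma>\<in>simplices X (Suc k). of_int (incidence ori \<sigma> \<tau>)
           * (\<Sum>\<tau>'\<in>simplices X k. of_int (incidence ori \<sigma> \<tau>') * y \<tau>')) = \<mu> * y \<tau>))"
proof -
  let ?T = "simplices X k" and ?S = "simplices X (Suc k)"
  let ?n = "card ?T" and ?m = "card ?S"
  let ?t = "from_nat_into ?T" and ?s = "from_nat_into ?S"
  define B where "B = boundary_matrix ori X (Suc k)"
  have B: "B \<in> carrier_mat ?n ?m" by (simp add: B_def boundary_matrix_def)
  have entry: "B $$ (i, l) = of_int (incidence ori (?s l) (?t i))" if "i < ?n" "l < ?m" for i l
    using that by (simp add: B_def boundary_matrix_def)
  have L: "up_laplacian ori X k = B * transpose_mat B" by (simp add: up_laplacian_def B_def)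
  have t: "bij_betw ?t {..<?n} ?T" and s: "bij_betw ?s {..<?m} ?S"
    using assms by (auto intro!: bij_betw_from_nat_into_finite simp: simplices_def)
  have index: "\<exists>i<?n. \<tau> = ?t i" if "\<tau> \<in> ?T" for \<tau>
    using t that unfolding bij_betw_def by (metis imageE lessThan_iff)
  have mult: "(up_laplacian ori X k *\<^sub>v v) $ i =
      (\<Sum>\<sigma>\<in>?S. of_int (incidence ori \<sigma> (?t i)) * (\<Sum>\<tau>'\<in>?T. of_int (incidence ori \<sigma> \<tau>') * y \<tau>'))"
    if i: "i < ?n" and v: "v \<in> carrier_vec ?n" and y: "\<And>j. j < ?n \<Longrightarrow> v $ j = y (?t j)"
    for v y i
  proof -
    have inner: "(transpose_mat B *\<^sub>v v) $ l = (\<Sum>\<tau>'\<in>?T. of_int (incidence ori (?s l) \<tau>') * y \<tau>')"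
      if "l < ?m" for l
    proof -
      have "(transpose_mat B *\<^sub>v v) $ l = (\<Sum>j<?n. B $$ (j, l) * v $ j)"
        using B v that by (simp add: scalar_prod_def atLeast0LessThan)
      also have "\<dots> = (\<Sum>j<?n. of_int (incidence ori (?s l) (?t j)) * y (?t j))"
        using that y by (intro sum.cong refl) (simp add: entry)
      also have "\<dots> = (\<Sum>\<tau>'\<in>?T. of_int (incidence ori (?s l) \<tau>') * y \<tau>')"
        by (rule sum.reindex_bij_betw[OF t])
      finally show ?thesis .
    qed
    have "(up_laplacian ori X k *\<^sub>v v) $ i = (B *\<^sub>v (transpose_mat B *\<^sub>v v)) $ i"
      using B v by (simp add: L)
    also have "\<dots> = (\<Sum>l<?m. B $$ (i, l) * (transpose_mat B *\<^sub>v v) $ l)"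
      using B i by (simp add: scalar_prod_def atLeast0LessThan)
    also have "\<dots> = (\<Sum>l<?m. of_int (incidence ori (?s l) (?t i))
        * (\<Sum>\<tau>'\<in>?T. of_int (incidence ori (?s l) \<tau>') * y \<tau>'))"
      using i by (intro sum.cong refl) (simp add: entry inner)
    also have "\<dots> = (\<Sum>\<sigma>\<in>?S. of_int (incidence ori \<sigma> (?t i))
        * (\<Sum>\<tau>'\<in>?T. of_int (incidence ori \<sigma> \<tau>') * y \<tau>'))"
      by (rule sum.reindex_bij_betw[OF s])
    finally show ?thesis .
  qed
  have dim: "dim_row (up_laplacian ori X k) = ?n" using up_laplacian_carrier by blast
  show ?thesis
  proof
    assume "eigenvalue (up_laplacian ori X k) \<mu>"
    then obtain v where v: "v \<in> carrier_vec ?n" "v \<noteq> 0\<^sub>v ?n"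
      "up_laplacian ori X k *\<^sub>v v = \<mu> \<cdot>\<^sub>v v"
      unfolding eigenvalue_def eigenvector_def dim by blast
    define y where "y \<tau> = v $ the_inv_into {..<?n} ?t \<tau>" for \<tau>
    have y: "v $ j = y (?t j)" if "j < ?n" for j
      using t that by (simp add: y_def the_inv_into_f_f bij_betw_def)
    obtain j where j: "j < ?n" "v $ j \<noteq> 0" using v(1,2) by (metis eq_vecI carrier_vecD index_zero_vec)
    have "?t j \<in> ?T" using bij_betw_apply[OF t] j(1) by simp
    moreover have "y (?t j) \<noteq> 0" using j y by simp
    moreover have "(\<Sum>\<sigma>\<in>?S. of_int (incidence ori \<sigma> \<tau>) * (\<Sum>\<tau>'\<in>?T. of_int (incidence ori \<sigma> \<tau>') * y \<tau>'))
        = \<mu> * y \<tau>" if "\<tau> \<in> ?T" for \<tau>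
    proof -
      obtain i where i: "i < ?n" "\<tau> = ?t i" using index[OF \<open>\<tau> \<in> ?T\<close>] by blast
      show ?thesis using mult[where y = y, OF i(1) v(1) y] i v(1) y[OF i(1)] unfolding v(3) by simp
    qed
    ultimately show "\<exists>y. (\<exists>\<tau>\<in>?T. y \<tau> \<noteq> 0) \<and> (\<forall>\<tau>\<in>?T. (\<Sum>\<sigma>\<in>?S. of_int (incidence ori \<sigma> \<tau>)
           * (\<Sum>\<tau>'\<in>?T. of_int (incidence ori \<sigma> \<tau>') * y \<tau>')) = \<mu> * y \<tau>)" by blast
  next
    assume "\<exists>y. (\<exists>\<tau>\<in>?T. y \<tau> \<noteq> 0) \<and> (\<forall>\<tau>\<in>?T. (\<Sum>\<sigma>\<in>?S. of_int (incidence ori \<sigma> \<tau>)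
           * (\<Sum>\<tau>'\<in>?T. of_int (incidence ori \<sigma> \<tau>') * y \<tau>')) = \<mu> * y \<tau>)"
    then obtain y \<tau> where \<tau>: "\<tau> \<in> ?T" "y \<tau> \<noteq> 0"
      and eq: "\<And>\<tau>. \<tau> \<in> ?T \<Longrightarrow> (\<Sum>\<sigma>\<in>?S. of_int (incidence ori \<sigma> \<tau>)
           * (\<Sum>\<tau>'\<in>?T. of_int (incidence ori \<sigma> \<tau>') * y \<tau>')) = \<mu> * y \<tau>" by blast
    obtain i where i: "i < ?n" "\<tau> = ?t i" using index[OF \<tau>(1)] by blast
    let ?v = "vec ?n (\<lambda>j. y (?t j))"
    have "?v $ i \<noteq> 0" using i \<tau>(2) by simp
    then have "?v \<noteq> 0\<^sub>v ?n" using i(1) by (metis index_zero_vec(1))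
    moreover have "up_laplacian ori X k *\<^sub>v ?v = \<mu> \<cdot>\<^sub>v ?v"
    proof (rule eq_vecI)
      fix j assume "j < dim_vec (\<mu> \<cdot>\<^sub>v ?v)"
      then have j: "j < ?n" by simp
      then have "?t j \<in> ?T" using bij_betw_apply[OF t] by simp
      then have "(up_laplacian ori X k *\<^sub>v ?v) $ j = \<mu> * y (?t j)"
        using eq mult[OF j, of ?v y] by simp
      then show "(up_laplacian ori X k *\<^sub>v ?v) $ j = (\<mu> \<cdot>\<^sub>v ?v) $ j" using j by simp
    qed (simp add: dim)
    ultimately show "eigenvalue (up_laplacian ori X k) \<mu>"
      unfolding eigenvalue_def eigenvector_def dim by (intro exI[of _ ?v]) simp
  qed
qed

lemma up_laplacian_symmetric: "transpose_mat (up_laplacian ori X k) = up_laplacian ori X k"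
  unfolding up_laplacian_def
  by (subst transpose_mult[of _ "card (simplices X k)" "card (simplices X (k + 1))"])
    (auto simp: boundary_matrix_def)

text \<open>Over the complex numbers an eigenvalue \<open>\<mu>\<close> exists. With an eigenvector \<open>v\<close>, the number
  \<open>q = \<mu> * (norm v)\<^sup>2\<close> is the value of the Hermitian form of the matrix at \<open>v\<close>, which is real by symmetry. So
  \<open>\<mu>\<close> is a real root of the characteristic polynomial.\<close>

lemma symmetric_spectrum_nonempty:
  fixes A :: "real mat"
  assumes A: "A \<in> carrier_mat n n" and "n > 0" and sym: "transpose_mat A = A"
  shows "spectrum A \<noteq> {}"
proof -
  let ?C = "map_mat complex_of_real A"
  have C: "?C \<in> carrier_mat n n" using A by simp
  obtain \<mu> where \<mu>: "eigenvalue ?C \<mu>"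
    using spectrum_non_empty[OF C] assms(2) by (auto simp: spectrum_def)
  then obtain v where v: "v \<in> carrier_vec n" "v \<noteq> 0\<^sub>v n" "?C *\<^sub>v v = \<mu> \<cdot>\<^sub>v v"
    using C by (auto simp: eigenvalue_def eigenvector_def)
  have row: "(\<Sum>j<n. of_real (A $$ (i, j)) * v $ j) = \<mu> * v $ i" if "i < n" for i
  proof -
    have "(?C *\<^sub>v v) $ i = (\<Sum>j<n. of_real (A $$ (i, j)) * v $ j)"
      using A v(1) that by (simp add: scalar_prod_def atLeast0LessThan)
    then show ?thesis using v(1,3) that by simp
  qed
  have A_sym: "A $$ (i, j) = A $$ (j, i)" if "i < n" "j < n" for i j
    using sym A that by (metis carrier_matD index_transpose_mat(1))
  define N where "N = (\<Sum>i<n. (cmod (v $ i))\<^sup>2)"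
  define q where "q = (\<Sum>i<n. cnj (v $ i) * (\<Sum>j<n. of_real (A $$ (i, j)) * v $ j))"
  have q: "q = \<mu> * of_real N"
  proof -
    have "q = (\<Sum>i<n. \<mu> * (v $ i * cnj (v $ i)))"
      unfolding q_def using row by (intro sum.cong) (auto simp: mult_ac)
    also have "\<dots> = \<mu> * of_real N"
      unfolding N_def sum_distrib_left[symmetric] of_real_sum complex_norm_square[symmetric] by simp
    finally show ?thesis .
  qed
  have "cnj q = (\<Sum>i<n. \<Sum>j<n. of_real (A $$ (i, j)) * (v $ i * cnj (v $ j)))"
    unfolding q_def by (simp add: sum_distrib_left mult_ac)
  also have "\<dots> = (\<Sum>j<n. \<Sum>i<n. of_real (A $$ (i, j)) * (v $ i * cnj (v $ j)))"
    by (rule sum.swap)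
  also have "\<dots> = q"
    unfolding q_def sum_distrib_left using A_sym by (intro sum.cong refl) (auto simp: mult_ac)
  finally have "q \<in> \<real>" by (simp add: Reals_cnj_iff)
  moreover have "N \<noteq> 0"
  proof
    assume "N = 0"
    then have "\<forall>i<n. v $ i = 0" by (auto simp: N_def sum_nonneg_eq_0_iff)
    then show False using v(1,2) by (metis eq_vecI carrier_vecD index_zero_vec)
  qed
  ultimately have "\<mu> \<in> \<real>"
    by (metis q Reals_divide Reals_of_real nonzero_mult_div_cancel_right of_real_eq_0_iff)
  then obtain x where x: "\<mu> = of_real x" by (auto elim: Reals_cases)
  have "poly (char_poly ?C) (of_real x) = 0"
    using \<mu> x eigenvalue_root_char_poly[OF C] by simp
  moreover have "char_poly ?C = map_poly of_real (char_poly A)"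
    by (rule of_real_hom.char_poly_hom[OF A])
  ultimately have "poly (char_poly A) x = 0" by simp
  then show ?thesis using eigenvalue_root_char_poly[OF A] by (auto simp: spectrum_def)
qed

section \<open>Eigenvalues and conjugate degrees\<close>

context oriented_complex
begin

text \<open>Both the upper bound and the case of equality come from this refinement of
  \<open>\<mu> \<le> conj_degree X k 1\<close>. It records the two kinds of loss in the estimate: the excess of the
  degree of \<open>\<tau>\<close> over 1, and the simplices of positive degree whose Hodge Laplacian entry in the row of
  \<open>\<tau>\<close> is zero although they do not span a \<open>(k + 1)\<close>-simplex with \<open>\<tau>\<close>.\<close>

lemma eigenvalue_gap:
  assumes "k \<ge> 1" "eigenvalue (up_laplacian ori X k) \<mu>" "\<mu> > 0"
  obtains \<tau> where "\<tau> \<in> simplices X k" "simplex_degree X k \<tau> \<ge> 1"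
    "\<mu> + real k * (real (simplex_degree X k \<tau>) - 1)
       + real (card {\<tau>' \<in> simplices X k. simplex_degree X k \<tau>' \<ge> 1 \<and> \<tau>' \<noteq> \<tau>
           \<and> \<tau>' \<union> \<tau> \<notin> simplices X (Suc k) \<and> card (\<tau>' \<inter> \<tau>) \<noteq> k})
     \<le> real (conj_degree X k 1)"
proof -
  obtain y \<tau>1 where y: "\<tau>1 \<in> simplices X k" "y \<tau>1 \<noteq> 0"
    "\<And>\<tau>. \<tau> \<in> simplices X k \<Longrightarrow>
      (\<Sum>\<sigma>\<in>simplices X (Suc k). inc \<sigma> \<tau> * (\<Sum>\<tau>'\<in>simplices X k. inc \<sigma> \<tau>' * y \<tau>')) = \<mu> * y \<tau>"
    using assms(2) unfolding eigenvalue_up_laplacian_iff[OF finite_complex] by blast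
  obtain \<tau> where \<tau>: "\<tau> \<in> simplices X k" "simplex_degree X k \<tau> \<ge> 1"
    and bound: "\<mu> \<le> real (simplex_degree X k \<tau>) + real (k + 1)
       + real (card {\<tau>' \<in> simplices X k. simplex_degree X k \<tau>' \<ge> 1 \<and> \<tau>' \<noteq> \<tau>
           \<and> \<tau>' \<union> \<tau> \<notin> X \<and> card (\<tau>' \<inter> \<tau>) = k})" (is "_ \<le> _ + real (card ?P)")
    by (rule hodge_gershgorin[OF assms(1,3) y])
  let ?R = "{\<tau>' \<in> simplices X k. simplex_degree X k \<tau>' \<ge> 1 \<and> \<tau>' \<noteq> \<tau> \<and> \<tau>' \<union> \<tau> \<notin> simplices X (Suc k)}"
  let ?Q = "{\<tau>' \<in> simplices X k. simplex_degree X k \<tau>' \<ge> 1 \<and> \<tau>' \<noteq> \<tau>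
    \<and> \<tau>' \<union> \<tau> \<notin> simplices X (Suc k) \<and> card (\<tau>' \<inter> \<tau>) \<noteq> k}"
  have "card ?P + card ?Q = card (?P \<union> ?Q)"
    using finite_simplices by (intro card_Un_disjoint[symmetric]) auto
  also have "\<dots> \<le> card ?R"
    by (intro card_mono finite_subset[OF _ finite_simplices[of k]]) (auto simp: simplices_def)
  finally have "real (card ?P) + real (card ?Q) \<le> real (card ?R)" by linarith
  moreover have "real (conj_degree X k 1)
      = 1 + real (k + 1) * real (simplex_degree X k \<tau>) + real (card ?R)"
    unfolding conj_degree_partition[OF \<tau>] by (simp only: of_nat_add of_nat_mult of_nat_1)
  ultimately have "\<mu> + real k * (real (simplex_degree X k \<tau>) - 1) + real (card ?Q)
      \<le> real (conj_degree X k 1)"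
    using bound by (simp add: algebra_simps)
  with \<tau> show ?thesis by (rule that)
qed

lemma eigenvalue_le_conj_degree:
  assumes "k \<ge> 1" "eigenvalue (up_laplacian ori X k) \<mu>"
  shows "\<mu> \<le> real (conj_degree X k 1)"
proof (cases "\<mu> > 0")
  case True
  obtain \<tau> where \<tau>: "simplex_degree X k \<tau> \<ge> 1"
    and gap: "\<mu> + real k * (real (simplex_degree X k \<tau>) - 1)
       + real (card {\<tau>' \<in> simplices X k. simplex_degree X k \<tau>' \<ge> 1 \<and> \<tau>' \<noteq> \<tau>
           \<and> \<tau>' \<union> \<tau> \<notin> simplices X (Suc k) \<and> card (\<tau>' \<inter> \<tau>) \<noteq> k})
     \<le> real (conj_degree X k 1)"
    by (rule eigenvalue_gap[OF assms True])
  have "real k * (real (simplex_degree X k \<tau>) - 1) \<ge> 0" using \<tau> by simp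
  with gap show ?thesis by linarith
next
  case False
  then have "\<mu> \<le> 0" by simp
  also have "0 \<le> real (conj_degree X k 1)" by simp
  finally show ?thesis .
qed

lemma unique_simplex_of_eigenvalue:
  assumes "k \<ge> 1" "eigenvalue (up_laplacian ori X k) (real (conj_degree X k 1))"
    "conj_degree X k 1 > 0"
  shows "card (simplices X (Suc k)) = 1"
proof -
  have "real (conj_degree X k 1) > 0" using assms(3) by simp
  then obtain \<tau> where \<tau>: "\<tau> \<in> simplices X k" "simplex_degree X k \<tau> \<ge> 1"
    and gap: "real (conj_degree X k 1) + real k * (real (simplex_degree X k \<tau>) - 1)
       + real (card {\<tau>' \<in> simplices X k. simplex_degree X k \<tau>' \<ge> 1 \<and> \<tau>' \<noteq> \<tau>
           \<and> \<tau>' \<union> \<tau> \<notin> simplices X (Suc k) \<and> card (\<tau>' \<inter> \<tau>) \<noteq> k})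
     \<le> real (conj_degree X k 1)" (is "_ + _ + real (card ?Q) \<le> _")
    by (rule eigenvalue_gap[OF assms(1,2)])
  have "real k * (real (simplex_degree X k \<tau>) - 1) \<ge> 0" using \<tau>(2) by simp
  with gap have "real k * (real (simplex_degree X k \<tau>) - 1) = 0" "card ?Q = 0" by linarith+
  then have "simplex_degree X k \<tau> = 1" "?Q = {}" using assms(1) finite_simplices by simp_all
  then show ?thesis using \<tau>(1) by (intro unique_simplex[OF assms(1), of \<tau>]) blast+
qed

lemma conj_degree_pos:
  assumes "simplices X (Suc k) \<noteq> {}"
  shows "conj_degree X k 1 > 0"
proof -
  obtain \<sigma> where \<sigma>: "\<sigma> \<in> simplices X (Suc k)" using assms by blast
  then have "\<sigma> \<in> X" "k + 1 \<le> card \<sigma>" by (auto simp: simplices_def)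
  from this(2) obtain \<tau> where \<tau>: "\<tau> \<subseteq> \<sigma>" "card \<tau> = k + 1" "finite \<tau>"
    by (rule obtain_subset_with_card_n)
  then have "\<tau> \<in> simplices X k" using face_closed[OF \<open>\<sigma> \<in> X\<close>] by (simp add: simplices_def)
  moreover have "simplex_degree X k \<tau> \<ge> 1"
    using \<sigma> \<tau>(1) finite_simplices[of "Suc k"] by (auto simp: simplex_degree_def Suc_le_eq card_gt_0_iff)
  ultimately show ?thesis
    using finite_simplices[of k] by (auto simp: conj_degree_def card_gt_0_iff)
qed

text \<open>The matrix \<open>B B\<^sup>T\<close> has rank one here, and its image is spanned by the incidence vector of \<open>\<sigma>\<close>,
  whose squared norm is the number of facets of \<open>\<sigma>\<close>.\<close>

lemma single_simplex:
  assumes "simplices X (Suc k) = {\<sigma>}"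
  shows "conj_degree X k 1 = k + 2" "eigenvalue (up_laplacian ori X k) (real (k + 2))"
proof -
  have \<sigma>: "\<sigma> \<in> X" "finite \<sigma>" "card \<sigma> = k + 2" using assms finite_simplex by (auto simp: simplices_def)
  have facets: "{\<tau> \<in> simplices X k. \<tau> \<subseteq> \<sigma>} = {\<tau>. \<tau> \<subseteq> \<sigma> \<and> card \<tau> = k + 1}"
    using face_closed[OF \<sigma>(1)] by (auto simp: simplices_def)
  have card: "card {\<tau> \<in> simplices X k. \<tau> \<subseteq> \<sigma>} = k + 2"
    unfolding facets using n_subsets[OF \<sigma>(2), of "k + 1"] \<sigma>(3) by simp
  have "simplex_degree X k \<tau> \<ge> 1 \<longleftrightarrow> \<tau> \<subseteq> \<sigma>" for \<tau>
  proof -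
    have "{F \<in> {\<sigma>}. \<tau> \<subseteq> F} = (if \<tau> \<subseteq> \<sigma> then {\<sigma>} else {})" by auto
    then show ?thesis unfolding simplex_degree_def using assms by simp
  qed
  then show "conj_degree X k 1 = k + 2" using card by (simp add: conj_degree_def)
  have "(\<Sum>\<tau>\<in>simplices X k. inc \<sigma> \<tau> * inc \<sigma> \<tau>) = (\<Sum>\<tau>\<in>simplices X k. if \<tau> \<subseteq> \<sigma> then 1 else 0)"
    using \<sigma> by (intro sum.cong refl) (auto simp: simplices_def inc_square inc_eq_0)
  also have "\<dots> = real (k + 2)"
    using card finite_simplices by (simp add: sum.If_cases Int_def)
  finally have norm: "(\<Sum>\<tau>\<in>simplices X k. inc \<sigma> \<tau> * inc \<sigma> \<tau>) = real (k + 2)" .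
  have "\<exists>\<tau>\<in>simplices X k. inc \<sigma> \<tau> \<noteq> 0"
  proof (rule ccontr)
    assume "\<not> ?thesis"
    then show False using norm by simp
  qed
  moreover have "\<forall>\<tau>\<in>simplices X k. (\<Sum>\<sigma>'\<in>simplices X (Suc k).
      inc \<sigma>' \<tau> * (\<Sum>\<tau>'\<in>simplices X k. inc \<sigma>' \<tau>' * inc \<sigma> \<tau>')) = real (k + 2) * inc \<sigma> \<tau>"
    unfolding assms by (simp add: norm mult.commute del: of_nat_add)
  ultimately show "eigenvalue (up_laplacian ori X k) (real (k + 2))"
    unfolding eigenvalue_up_laplacian_iff[OF finite_complex]
    by (intro exI[of _ "\<lambda>\<tau>. inc \<sigma> \<tau>"] conjI)
qed

end

theorem corollary1:
  fixes V :: "'a set" and X :: "'a set set"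
    and ori :: "'a set \<Rightarrow> 'a list" and r :: nat
  assumes "finite V"
    and "abstract_complex V X"
    and "complex_dim X = int r"
    and "r \<ge> 2"
    and "orientation X ori"
  shows "largest_eigenvalue (up_laplacian ori X (r - 1)) = real (conj_degree X (r - 1) 1)
         \<longleftrightarrow> f_number X r = 1"
proof -
  define k where "k = r - 1"
  have k: "k \<ge> 1" "Suc k = r" using assms(4) by (auto simp: k_def)
  have X: "X \<subseteq> Pow V" "{} \<in> X" using assms(2) by (auto simp: abstract_complex_def)
  interpret oriented_complex X ori
  proof
    show "finite X" using X(1) assms(1) finite_subset by auto
    show "finite \<sigma>" if "\<sigma> \<in> X" for \<sigma>
      using X(1) that finite_subset[OF _ assms(1), of \<sigma>] by auto
    show "\<tau> \<in> X" if "\<sigma> \<in> X" "\<tau> \<subseteq> \<sigma>" for \<sigma> \<tau>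
      using assms(2) that by (auto simp: abstract_complex_def)
  qed (rule assms(5))
  let ?L = "up_laplacian ori X k" and ?d = "conj_degree X k 1"
  have "complex_dim X \<in> (\<lambda>\<sigma>. int (card \<sigma>) - 1) ` X"
    unfolding complex_dim_def using X(2) finite_complex by (intro Max_in) auto
  then obtain \<sigma> where "\<sigma> \<in> X" "int r = int (card \<sigma>) - 1" unfolding assms(3) by blast
  then have ne: "simplices X (Suc k) \<noteq> {}" unfolding k(2) simplices_def by auto
  then have pos: "?d > 0" by (rule conj_degree_pos)
  then have "{\<tau> \<in> simplices X k. 1 \<le> simplex_degree X k \<tau>} \<noteq> {}"
    unfolding conj_degree_def card_gt_0_iff by blast
  then have "card (simplices X k) > 0" using finite_simplices[of k] by (auto simp: card_gt_0_iff)
  then have "spectrum ?L \<noteq> {}"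
    by (rule symmetric_spectrum_nonempty[OF up_laplacian_carrier _ up_laplacian_symmetric])
  moreover have fin: "finite (spectrum ?L)"
    by (rule card_finite_spectrum(1)[OF up_laplacian_carrier])
  ultimately have Max_spectrum: "Max (spectrum ?L) \<in> spectrum ?L" by (intro Max_in)
  have "largest_eigenvalue ?L = real ?d \<longleftrightarrow> card (simplices X (Suc k)) = 1"
  proof
    assume "largest_eigenvalue ?L = real ?d"
    then have "eigenvalue ?L (real ?d)"
      using Max_spectrum unfolding largest_eigenvalue_def spectrum_def by simp
    then show "card (simplices X (Suc k)) = 1"
      by (rule unique_simplex_of_eigenvalue[OF k(1) _ pos])
  next
    assume "card (simplices X (Suc k)) = 1"
    then obtain \<sigma> where "simplices X (Suc k) = {\<sigma>}" by (rule card_1_singletonE)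
    note single = single_simplex[OF this]
    have "real ?d \<in> spectrum ?L"
      unfolding spectrum_def single(1) using single(2) by (rule CollectI)
    then show "largest_eigenvalue ?L = real ?d"
      unfolding largest_eigenvalue_def
    proof (intro Max_eqI fin)
      fix \<mu> assume "\<mu> \<in> spectrum ?L"
      then show "\<mu> \<le> real ?d"
        by (intro eigenvalue_le_conj_degree[OF k(1)]) (simp add: spectrum_def)
    qed
  qed
  then show ?thesis unfolding f_number_def k(2) unfolding k_def .
qed

end
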